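(* Let $\|\cdot\|$ be a sub-multiplicative norm on the real polynomial ring $\mathbb{R}[\underline X]=\mathbb{R}[X_1,\dots,X_n]$, i.e. $\|f\cdot g\|\le\|f\|\cdot\|g\|$ for all $f,g\in\mathbb{R}[\underline X]$. Then the $\|\cdot\|$-topology is finer than the $\|\cdot\|_{\mathcal{K}_{\|\cdot\|}}$-topology and $$\overline{\sum\mathbb{R}[\underline X]^{2d}}^{\,\|\cdot\|}=\overline{\sum\mathbb{R}[\underline X]^{2d}}^{\,\|\cdot\|_{\mathcal{K}_{\|\cdot\|}}}=\mathrm{Psd}(\mathcal{K}_{\|\cdot\|})$$ for every integer $d\ge1$.
   Context: The unitary $\mathbb{R}$-algebra homomorphisms $\mathbb{R}[\underline X]\to\mathbb{R}$ are identified with points $x\in\mathbb{R}^n$ via $f\mapsto f(x)$. $\mathcal{K}_{\|\cdot\|}\subseteq\mathbb{R}^n$ (the Gelfand spectrum of $(\mathbb{R}[\underline X],\|\cdot\|)$) is the set of $x\in\mathbb{R}^n$ such that $f\mapsto f(x)$ is $\|\cdot\|$-continuous; it is a compact set. For compact $K\subseteq\mathbb{R}^n$, $\|f\|_K:=\sup_{x\in K}|f(x)|$ (the supremum over the empty set being $0$), a seminorm on $\mathbb{R}[\underline X]$ defining the $\|\cdot\|_K$-topology. $\sum\mathbb{R}[\underline X]^{2d}$ is the set of finite sums of $2d$-th powers of polynomials. $\mathrm{Psd}(K):=\{f\in\mathbb{R}[\underline X]:f(x)\ge0\text{ for all }x\in K\}$. "Finer" is meant in the non-strict sense. Overlines denote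 closures in the indicated topologies. *)

theory Defs
  imports "HOL-Analysis.Analysis" "HOL-Library.Poly_Mapping"
begin

text \<open>
  A real polynomial in finitely many indeterminates, indexed by \<open>'n\<close>, is a finitely supported
  function from exponent vectors to coefficients; multiplication on this type is convolution.
\<close>

type_synonym 'n rpoly = "('n \<Rightarrow>\<^sub>0 nat) \<Rightarrow>\<^sub>0 real"

definition const_poly :: "real \<Rightarrow> 'n rpoly" where
  "const_poly c = Poly_Mapping.single 0 c"

definition poly_eval :: "real ^ 'n::finite \<Rightarrow> 'n rpoly \<Rightarrow> real" where
  "poly_eval x f =
     (\<Sum>m\<in>Poly_Mapping.keys f. Poly_Mapping.lookup f m * (\<Prod>i\<in>UNIV. (x $ i) ^ Poly_Mapping.lookup m i))"

text \<open>
  The library has no real vector space structure on this type, so scalar multiplication by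
  \<open>c\<close> is written as multiplication by the constant polynomial \<open>c\<close>.
\<close>

definition is_poly_norm :: "('n rpoly \<Rightarrow> real) \<Rightarrow> bool" where
  "is_poly_norm N \<longleftrightarrow>
     (\<forall>f. 0 \<le> N f) \<and>
     (\<forall>f. N f = 0 \<longleftrightarrow> f = 0) \<and>
     (\<forall>f g. N (f + g) \<le> N f + N g) \<and>
     (\<forall>c f. N (const_poly c * f) = \<bar>c\<bar> * N f)"

text \<open>
  The topology of a seminorm need not be Hausdorff, so the metric topologies of the library
  do not cover it.
\<close>

definition seminorm_topology :: "('a::ab_group_add \<Rightarrow> real) \<Rightarrow> 'a topology" where
  "seminorm_topology p =
     topology (\<lambda>U. \<forall>f\<in>U. \<exists>e>0. \<forall>g. p (g - f) < e \<longrightarrow> g \<in> U)"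

lemma openin_seminorm_topology:
  "openin (seminorm_topology p) U \<longleftrightarrow> (\<forall>f\<in>U. \<exists>e>0. \<forall>g. p (g - f) < e \<longrightarrow> g \<in> U)"
proof -
  have "istopology (\<lambda>U. \<forall>f\<in>U. \<exists>e>0. \<forall>g. p (g - f) < e \<longrightarrow> g \<in> U)"
    unfolding istopology_def
  proof (intro conjI allI impI ballI)
    fix S T f
    assume S: "\<forall>f\<in>S. \<exists>e>0. \<forall>g. p (g - f) < e \<longrightarrow> g \<in> S"
      and T: "\<forall>f\<in>T. \<exists>e>0. \<forall>g. p (g - f) < e \<longrightarrow> g \<in> T"
      and f: "f \<in> S \<inter> T"
    from S f obtain d where d: "d > 0" "\<forall>g. p (g - f) < d \<longrightarrow> g \<in> S" by blast
    from T f obtain e where e: "e > 0" "\<forall>g. p (g - f) < e \<longrightarrow> g \<in> T" by blast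
    show "\<exists>e>0. \<forall>g. p (g - f) < e \<longrightarrow> g \<in> S \<inter> T"
      by (rule exI[of _ "min d e"]) (use d e in auto)
  next
    fix \<K> f
    assume "\<forall>K\<in>\<K>. \<forall>f\<in>K. \<exists>e>0. \<forall>g. p (g - f) < e \<longrightarrow> g \<in> K" and "f \<in> \<Union>\<K>"
    then show "\<exists>e>0. \<forall>g. p (g - f) < e \<longrightarrow> g \<in> \<Union>\<K>"
      by (meson UnionE UnionI)
  qed
  then show ?thesis
    by (simp add: seminorm_topology_def)
qed

lemma topspace_seminorm_topology [simp]: "topspace (seminorm_topology p) = UNIV"
proof -
  have "openin (seminorm_topology p) UNIV"
    by (auto simp: openin_seminorm_topology intro: exI[of _ 1])
  then show ?thesis
    using openin_subset by blast
qed

definition gelfand_spectrum :: "('n rpoly \<Rightarrow> real) \<Rightarrow> (real ^ 'n::finite) set" where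
  "gelfand_spectrum N =
     {x. continuous_map (seminorm_topology N) euclideanreal (poly_eval x)}"

text \<open>For compact \<open>K\<close>; on unbounded value sets the real supremum is unspecified.\<close>

definition sup_seminorm :: "(real ^ 'n::finite) set \<Rightarrow> 'n rpoly \<Rightarrow> real" where
  "sup_seminorm K f = (if K = {} then 0 else (SUP x\<in>K. \<bar>poly_eval x f\<bar>))"

definition sums_of_powers :: "nat \<Rightarrow> ('n rpoly) set" where
  "sums_of_powers k = {f. \<exists>(r::nat) g. f = (\<Sum>i<r. g i ^ k)}"

definition Psd :: "(real ^ 'n::finite) set \<Rightarrow> ('n rpoly) set" where
  "Psd K = {f. \<forall>x\<in>K. 0 \<le> poly_eval x f}"

end

theory Submission imports Defs begin

text \<open>
  Let \<open>P\<close> be the \<open>N\<close>-closure of the cone of sums of \<open>2d\<close>-th powers. It is closed under addition and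
  multiplication, and since \<open>1 + g\<close> has approximate \<open>2d\<close>-th roots for small \<open>g\<close>, the constant 1 is an
  order unit. A polynomial \<open>f\<close> outside \<open>P\<close> is negative under some functional \<open>L\<close> that is nonnegative on
  \<open>P\<close> with \<open>L 1 = 1\<close>; choosing \<open>L\<close> extreme makes it multiplicative, because for \<open>g\<close> and \<open>1 - g\<close> in \<open>P\<close> both
  \<open>h \<mapsto> L (g h)\<close> and \<open>h \<mapsto> L ((1 - g) h)\<close> are nonnegative on \<open>P\<close> and add up to \<open>L\<close>. So \<open>L\<close> is evaluation at a
  point of the spectrum where \<open>f\<close> is negative. Polynomial rings have countable dimension, so an
  extreme \<open>L\<close> is obtained by successive maximization along a basis, without Krein--Milman.
\<close>

section \<open>Extreme functionals and characters\<close>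

locale real_scalars =
  fixes \<kappa> :: "real \<Rightarrow> 'a::comm_ring_1"
  assumes scalar_add: "\<kappa> (b + c) = \<kappa> b + \<kappa> c"
    and scalar_mult: "\<kappa> (b * c) = \<kappa> b * \<kappa> c"
    and scalar_1 [simp]: "\<kappa> 1 = 1"
begin

lemma scalar_0 [simp]: "\<kappa> 0 = 0"
  using scalar_add[of 0 0] by simp

lemma scalar_minus: "\<kappa> (- c) = - \<kappa> c"
  using scalar_add[of c "- c"] by (simp add: eq_neg_iff_add_eq_0 add.commute)

lemma scalar_diff: "\<kappa> (b - c) = \<kappa> b - \<kappa> c"
  using scalar_add[of b "- c"] by (simp add: scalar_minus)

lemma scalar_of_nat: "\<kappa> (real k) = of_nat k"
  by (induction k) (simp_all add: scalar_add)

lemma scalar_inverse_cancel [simp]: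
  assumes "c \<noteq> 0" shows "\<kappa> c * (\<kappa> (1 / c) * a) = a" "\<kappa> (1 / c) * (\<kappa> c * a) = a"
  using assms by (simp_all add: mult.assoc[symmetric] scalar_mult[symmetric])

definition sublinear :: "('a \<Rightarrow> real) \<Rightarrow> bool" where
  "sublinear p \<longleftrightarrow> (\<forall>a b. p (a + b) \<le> p a + p b) \<and> (\<forall>c a. c > 0 \<longrightarrow> p (\<kappa> c * a) = c * p a)"

definition linear_functional :: "('a \<Rightarrow> real) \<Rightarrow> bool" where
  "linear_functional L \<longleftrightarrow> (\<forall>a b. L (a + b) = L a + L b) \<and> (\<forall>c a. L (\<kappa> c * a) = c * L a)"

definition character :: "('a \<Rightarrow> real) \<Rightarrow> bool" where
  "character L \<longleftrightarrow> linear_functional L \<and> L 1 = 1 \<and> (\<forall>a b. L (a * b) = L a * L b)"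

text \<open>Linear spanning phrased as an induction principle: a subspace containing
  \<open>B\<close> is the whole algebra. It is applied in this form to a subspace given by a
  property of its elements.\<close>

definition spanning :: "'a set \<Rightarrow> bool" where
  "spanning B \<longleftrightarrow> (\<forall>S. B \<subseteq> S \<longrightarrow> 0 \<in> S \<longrightarrow> (\<forall>a\<in>S. \<forall>b\<in>S. a + b \<in> S) \<longrightarrow>
     (\<forall>c. \<forall>a\<in>S. \<kappa> c * a \<in> S) \<longrightarrow> S = UNIV)"

lemma spanning_mono:
  assumes "spanning A" "A \<subseteq> B"
  shows "spanning B"
  unfolding spanning_def
proof (intro allI impI)
  fix S assume "B \<subseteq> S" "0 \<in> S" "\<forall>a\<in>S. \<forall>b\<in>S. a + b \<in> S" "\<forall>c. \<forall>a\<in>S. \<kappa> c * a \<in> S"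
  moreover from this have "A \<subseteq> S" using assms(2) by blast
  ultimately show "S = UNIV" using assms(1) unfolding spanning_def by presburger
qed

lemma linear_functionalD:
  assumes "linear_functional L"
  shows "L (a + b) = L a + L b" "L (\<kappa> c * a) = c * L a" "L 0 = 0" "L (- a) = - L a"
    "L (a - b) = L a - L b" "L (\<kappa> c) = c * L 1"
proof -
  show add: "L (a + b) = L a + L b" for a b
    using assms by (auto simp: linear_functional_def)
  show hom: "L (\<kappa> c * a) = c * L a" for c a
    using assms by (auto simp: linear_functional_def)
  show "L 0 = 0" "L (- a) = - L a" "L (\<kappa> c) = c * L 1" for a
    using hom[of 0 0] hom[of "-1" a] hom[of c 1] by (simp_all add: scalar_minus)
  then show "L (a - b) = L a - L b"
    using add[of a "- b"] by simp
qed

lemma sublinearD: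
  assumes "sublinear p"
  shows "p (a + b) \<le> p a + p b" "c \<ge> 0 \<Longrightarrow> p (\<kappa> c * a) = c * p a" "p 0 = 0" "- p (- a) \<le> p a"
proof -
  show add: "p (a + b) \<le> p a + p b" for a b
    using assms by (auto simp: sublinear_def)
  have hom: "c > 0 \<Longrightarrow> p (\<kappa> c * a) = c * p a" for c a
    using assms by (auto simp: sublinear_def)
  from hom[of 2 0] show p0: "p 0 = 0" by simp
  show "c \<ge> 0 \<Longrightarrow> p (\<kappa> c * a) = c * p a"
    using hom[of c a] p0 by (cases "c = 0") auto
  show "- p (- a) \<le> p a"
    using add[of a "- a"] p0 by simp
qed

text \<open>Applying the one-sided bound to \<open>1 / c\<close> and \<open>\<kappa> c * a\<close>
  returns the reverse inequality, so for an infimum only the upper estimate has to be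
  proved.\<close>

lemma sublinearI:
  assumes add: "\<And>a b. p (a + b) \<le> p a + p b"
    and le: "\<And>c a. c > 0 \<Longrightarrow> p (\<kappa> c * a) \<le> c * p a"
  shows "sublinear p"
proof -
  have "c * p a \<le> p (\<kappa> c * a)" if "c > 0" for c a
    using mult_left_mono[OF le[of "1 / c" "\<kappa> c * a"], of c] that by simp
  then show ?thesis
    using add le by (auto simp: sublinear_def intro: antisym)
qed

text \<open>A linear \<open>L\<close> below \<open>p\<close> with \<open>L e = p e\<close> satisfies
  \<open>L g = L (g + \<kappa> t * e) - t * p e \<le> p (g + \<kappa> t * e) - t * p e\<close>. For
  sublinear \<open>p\<close>, the linear functionals below the infimum are exactly those below
  \<open>p\<close> that attain \<open>p e\<close> at \<open>e\<close>: \<open>t = 0\<close> gives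
  domination, and \<open>g = - e\<close>, \<open>t = 1\<close> gives attainment.\<close>

definition tighten :: "'a \<Rightarrow> ('a \<Rightarrow> real) \<Rightarrow> 'a \<Rightarrow> real" where
  "tighten e p g = (INF t\<in>{0..}. p (g + \<kappa> t * e) - t * p e)"

text \<open>Writing \<open>\<kappa> t * e\<close> as the sum of \<open>g + \<kappa> t * e\<close>
  and \<open>- g\<close> bounds the family uniformly in \<open>t\<close>, so the infimum in
  \<open>tighten\<close> is over a set bounded below.\<close>

lemma tighten_lower:
  assumes "sublinear p" "t \<ge> 0"
  shows "- p (- g) \<le> p (g + \<kappa> t * e) - t * p e"
  using sublinearD(1)[OF assms(1), of "g + \<kappa> t * e" "- g"] sublinearD(2)[OF assms, of e] by simp

lemma tighten_le:
  assumes "sublinear p" "t \<ge> 0"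
  shows "tighten e p g \<le> p (g + \<kappa> t * e) - t * p e"
  unfolding tighten_def
  by (rule cINF_lower[OF bdd_belowI2[of _ "- p (- g)"]]) (use assms tighten_lower in auto)

lemma tighten_ge:
  assumes "\<And>t. t \<ge> 0 \<Longrightarrow> b \<le> p (g + \<kappa> t * e) - t * p e"
  shows "b \<le> tighten e p g"
  unfolding tighten_def by (rule cINF_greatest) (use assms in auto)

text \<open>Parameters \<open>s\<close> for \<open>g\<close> and \<open>t\<close> for
  \<open>h\<close> combine to \<open>s + t\<close> for \<open>g + h\<close>, and scaling by
  \<open>c\<close> replaces \<open>t\<close> by \<open>c * t\<close>. The two infima on the right
  are removed one after the other.\<close>

lemma sublinear_tighten:
  assumes p: "sublinear p"
  shows "sublinear (tighten e p)"
proof -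
  have add: "tighten e p (g + h) \<le> tighten e p g + tighten e p h" for g h
  proof -
    have "tighten e p (g + h) - tighten e p h \<le> tighten e p g"
    proof (rule tighten_ge)
      fix s :: real assume s: "s \<ge> 0"
      have "tighten e p (g + h) - (p (g + \<kappa> s * e) - s * p e) \<le> tighten e p h"
      proof (rule tighten_ge)
        fix t :: real assume t: "t \<ge> 0"
        have "g + h + \<kappa> (s + t) * e = (g + \<kappa> s * e) + (h + \<kappa> t * e)"
          by (simp add: scalar_add algebra_simps)
        then show "tighten e p (g + h) - (p (g + \<kappa> s * e) - s * p e) \<le> p (h + \<kappa> t * e) - t * p e"
          using tighten_le[OF p, of "s + t" e "g + h"] s t
            sublinearD(1)[OF p, of "g + \<kappa> s * e" "h + \<kappa> t * e"]
          by (simp add: algebra_simps)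
      qed
      then show "tighten e p (g + h) - tighten e p h \<le> p (g + \<kappa> s * e) - s * p e" by simp
    qed
    then show ?thesis by simp
  qed
  have le: "tighten e p (\<kappa> c * g) \<le> c * tighten e p g" if c: "c > 0" for c g
  proof -
    have "tighten e p (\<kappa> c * g) / c \<le> tighten e p g"
    proof (rule tighten_ge)
      fix t :: real assume t: "t \<ge> 0"
      have "p (\<kappa> c * g + \<kappa> (c * t) * e) = c * p (g + \<kappa> t * e)"
        using sublinearD(2)[OF p, of c "g + \<kappa> t * e"] c by (simp add: scalar_mult algebra_simps)
      then have "tighten e p (\<kappa> c * g) \<le> c * (p (g + \<kappa> t * e) - t * p e)"
        using tighten_le[OF p, of "c * t" e "\<kappa> c * g"] c t by (simp add: algebra_simps)
      then show "tighten e p (\<kappa> c * g) / c \<le> p (g + \<kappa> t * e) - t * p e"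
        using c by (simp add: field_simps)
    qed
    then show ?thesis using c by (simp add: field_simps)
  qed
  from add le show ?thesis by (rule sublinearI)
qed

text \<open>Extremality among the linear functionals below \<open>p\<close>, with the convex
  combination kept homogeneous: \<open>M\<close> stands for \<open>c\<close> times one such
  functional and \<open>L - M\<close> for \<open>1 - c\<close> times another. This form also makes
  sense for \<open>c = 0\<close> and \<open>c = 1\<close>.\<close>

definition extreme_functional :: "('a \<Rightarrow> real) \<Rightarrow> ('a \<Rightarrow> real) \<Rightarrow> bool" where
  "extreme_functional p L \<longleftrightarrow> linear_functional L \<and> (\<forall>a. L a \<le> p a) \<and>
     (\<forall>M c. linear_functional M \<longrightarrow> 0 \<le> c \<longrightarrow> c \<le> 1 \<longrightarrow> (\<forall>a. M a \<le> c * p a) \<longrightarrow>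
        (\<forall>a. L a - M a \<le> (1 - c) * p a) \<longrightarrow> (\<forall>a. M a = c * L a))"

lemma extreme_functionalD:
  assumes "extreme_functional p L"
  shows "linear_functional L" "L a \<le> p a"
    "linear_functional M \<Longrightarrow> 0 \<le> c \<Longrightarrow> c \<le> 1 \<Longrightarrow> (\<And>a. M a \<le> c * p a) \<Longrightarrow>
       (\<And>a. L a - M a \<le> (1 - c) * p a) \<Longrightarrow> M a = c * L a"
  using assms by (auto simp: extreme_functional_def)

primrec tightened :: "(nat \<Rightarrow> 'a) \<Rightarrow> ('a \<Rightarrow> real) \<Rightarrow> nat \<Rightarrow> 'a \<Rightarrow> real" where
  "tightened e p 0 = p"
| "tightened e p (Suc k) = tighten (e k) (tightened e p k)"

text \<open>Maximizing successively on the values at \<open>e 0\<close>, \<open>e 1\<close>, \<dots> singles out an extreme point of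
  the convex set of linear functionals below \<open>p\<close>.\<close>

lemma extreme_functional_exists:
  fixes e :: "nat \<Rightarrow> 'a"
  assumes p: "sublinear p" and span: "spanning (range e)"
  obtains L where "extreme_functional p L" "L (e 0) = p (e 0)"
proof -
  define q where "q = tightened e p"
  have q0: "q 0 = p" and qS: "q (Suc k) = tighten (e k) (q k)" for k
    by (simp_all add: q_def)
  have sub: "sublinear (q k)" for k
    by (induction k) (simp_all add: q0 qS p sublinear_tighten)
  have dec: "q (Suc k) a \<le> q k a" for k a
    using tighten_le[OF sub[of k], of 0 "e k" a] by (simp add: qS)
  then have "decseq (\<lambda>k. q k a)" for a
    by (rule decseq_SucI)
  \<comment> \<open>The bound \<open>- q k (- a) \<le> q k a\<close> becomes uniform in
    \<open>k\<close> because \<open>q k (- a) \<le> p (- a)\<close>; the decreasing sequence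
    therefore converges.\<close>
  moreover from this have "- p (- a) \<le> q k a" for a k
    using sublinearD(4)[OF sub[of k], of a] decseqD[of "\<lambda>k. q k (- a)" 0 k] by (simp add: q0)
  ultimately have conv: "convergent (\<lambda>k. q k a)" and below: "decseq (\<lambda>k. q k a)" for a
    by (metis convergent_def decseq_convergent)+
  define L where "L a = lim (\<lambda>k. q k a)" for a
  have lim: "(\<lambda>k. q k a) \<longlonglongrightarrow> L a" for a
    using conv[of a] by (simp add: L_def convergent_LIMSEQ_iff)
  have Lq: "L a \<le> q k a" for k a
    using decseq_ge[OF below lim] .
  have subL: "sublinear L"
    unfolding sublinear_def
  proof (intro conjI allI impI)
    show "L (a + b) \<le> L a + L b" for a b
      by (rule LIMSEQ_le[OF lim tendsto_add[OF lim lim]]) (use sublinearD(1)[OF sub] in auto)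
    show "L (\<kappa> c * a) = c * L a" if "c > 0" for c a
      using LIMSEQ_unique[OF lim[of "\<kappa> c * a"]] tendsto_mult_left[OF lim[of a], of c]
        sublinearD(2)[OF sub, of c _ a] that by simp
  qed
  \<comment> \<open>The choice \<open>t = 1\<close> at \<open>- e k\<close> leaves
    \<open>q k 0 = 0\<close>. So from stage \<open>Suc k\<close> on, the value at \<open>e k\<close>
    is pinned to its maximum \<open>q k (e k)\<close>.\<close>
  have Le: "L (- e k) \<le> - q k (e k)" for k
    using Lq[of "- e k" "Suc k"] tighten_le[OF sub[of k], of 1 "e k" "- e k"] sublinearD(3)[OF sub[of k]]
    by (simp add: qS)
  then have Lek: "L (e k) = q k (e k)" for k
    using Lq[of "e k" k] sublinearD(4)[OF subL, of "e k"] Le[of k] by linarith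
  \<comment> \<open>The vectors at which \<open>L\<close> is odd form a subspace containing every
    \<open>e k\<close>, hence everything; an odd sublinear functional is linear.\<close>
  define S where "S = {a. L (- a) = - L a}"
  have S_I: "a \<in> S" if "L a + L (- a) \<le> 0" for a
    using sublinearD(4)[OF subL, of a] that by (simp add: S_def)
  have "S = UNIV"
  proof (rule span[unfolded spanning_def, rule_format])
    have "L (e k) + L (- e k) \<le> 0" for k
      using Le[of k] Lek[of k] by simp
    then show "range e \<subseteq> S"
      by (auto intro: S_I)
    show "0 \<in> S"
      using sublinearD(3)[OF subL] by (simp add: S_def)
    show "a + b \<in> S" if "a \<in> S" "b \<in> S" for a b
      using sublinearD(1)[OF subL, of a b] sublinearD(1)[OF subL, of "- a" "- b"] that
      by (intro S_I) (simp add: S_def)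
    show "\<kappa> c * a \<in> S" if "a \<in> S" for c a
      using sublinearD(2)[OF subL, of c a] sublinearD(2)[OF subL, of c "- a"]
        sublinearD(2)[OF subL, of "- c" a] sublinearD(2)[OF subL, of "- c" "- a"] that
      by (cases "c \<ge> 0") (auto simp: S_def scalar_minus)
  qed
  then have neg: "L (- a) = - L a" for a
    by (auto simp: S_def)
  have linL: "linear_functional L"
    unfolding linear_functional_def
  proof (intro conjI allI)
    show "L (a + b) = L a + L b" for a b
      using sublinearD(1)[OF subL, of a b] sublinearD(1)[OF subL, of "- a" "- b"] 
        neg[of a] neg[of b] neg[of "a + b"] by simp
    show "L (\<kappa> c * a) = c * L a" for c a
      using sublinearD(2)[OF subL, of c a] sublinearD(2)[OF subL, of "- c" a] neg[of "\<kappa> c * a"]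
      by (cases "c \<ge> 0") (auto simp: scalar_minus)
  qed
  have "M a = c * L a"
    if M: "linear_functional M" and Mp: "\<And>a. M a \<le> c * p a"
      and LMp: "\<And>a. L a - M a \<le> (1 - c) * p a" and c: "0 \<le> c" "c \<le> 1" for M c a
  proof -
    have bounds: "(\<forall>a. M a \<le> c * q k a) \<and> (\<forall>a. L a - M a \<le> (1 - c) * q k a)" for k
    proof (induction k)
      case 0
      then show ?case using Mp LMp by (simp add: q0)
    next
      case (Suc k)
      \<comment> \<open>The bounds for \<open>M\<close> and \<open>L - M\<close> at
        \<open>e k\<close> add up to \<open>q k (e k)\<close>, which \<open>L\<close> attains, so
        both are equalities. Hence both functionals respect the tightening at \<open>e k\<close>,
        and the domination passes to the next stage.\<close>
      then have ek: "M (e k) = c * q k (e k)"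
        using Lek[of k] by (smt (verit) left_diff_distrib mult_cancel_right1)
      have "M a \<le> c * q (Suc k) a" for a
      proof (cases "c = 0")
        case True
        then show ?thesis using Suc by simp
      next
        case False
        have "M a / c \<le> tighten (e k) (q k) a"
        proof (rule tighten_ge)
          fix t :: real
          have "M a + t * M (e k) \<le> c * q k (a + \<kappa> t * e k)"
            using Suc[THEN conjunct1, rule_format, of "a + \<kappa> t * e k"]
            by (simp add: linear_functionalD[OF M])
          then show "M a / c \<le> q k (a + \<kappa> t * e k) - t * q k (e k)"
            using c False ek by (simp add: field_simps)
        qed
        then show ?thesis using c False by (simp add: qS field_simps)
      qed
      moreover have "L a - M a \<le> (1 - c) * q (Suc k) a" for a
      proof (cases "c = 1")
        case True
        then show ?thesis using Suc by simp
      next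
        case False
        have "(L a - M a) / (1 - c) \<le> tighten (e k) (q k) a"
        proof (rule tighten_ge)
          fix t :: real
          have "(L a - M a) + t * (L (e k) - M (e k)) \<le> (1 - c) * q k (a + \<kappa> t * e k)"
            using Suc[THEN conjunct2, rule_format, of "a + \<kappa> t * e k"]
            by (simp add: linear_functionalD[OF M] linear_functionalD[OF linL] algebra_simps)
          moreover have "L (e k) - M (e k) = (1 - c) * q k (e k)"
            using ek Lek[of k] by (simp add: algebra_simps)
          ultimately have "(L a - M a) \<le> (q k (a + \<kappa> t * e k) - t * q k (e k)) * (1 - c)"
            by (simp add: algebra_simps)
          then show "(L a - M a) / (1 - c) \<le> q k (a + \<kappa> t * e k) - t * q k (e k)"
            using c False by (simp add: pos_divide_le_eq)
        qed
        then show ?thesis using c False by (simp add: qS pos_divide_le_eq mult.commute)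
      qed
      ultimately show ?case by blast
    qed
    \<comment> \<open>In the limit the majorant is the linear \<open>c * L\<close>; a linear
      functional below another one equals it, by passing to \<open>- a\<close>.\<close>
    have le: "M a \<le> c * L a" for a
      by (rule LIMSEQ_le_const[OF tendsto_mult_left[OF lim]]) (use bounds in auto)
    from le[of a] le[of "- a"] show ?thesis
      by (simp add: linear_functionalD[OF M] linear_functionalD[OF linL])
  qed
  moreover have "L a \<le> p a" for a
    using Lq[of a 0] by (simp add: q0)
  moreover have "L (e 0) = p (e 0)"
    using Lek[of 0] by (simp add: q0)
  ultimately show thesis
    using that[of L] linL by (simp add: extreme_functional_def)
qed

text \<open>The gauge \<open>p g\<close>, the infimum of all \<open>r\<close> with
  \<open>\<kappa> r - g \<in> P\<close>, dominates only linear functionals that are nonnegative on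
  \<open>P\<close> and normalized at 1, and an extreme one is multiplicative. The margin
  \<open>\<epsilon>\<close> yields \<open>p (- f) \<ge> \<epsilon>\<close>; since the infimum need
  not be attained, \<open>f \<notin> P\<close> alone would not make the value at \<open>f\<close>
  strictly negative.\<close>

lemma positive_character_exists:
  fixes B :: "nat \<Rightarrow> 'a"
  assumes add: "\<And>a b. a \<in> P \<Longrightarrow> b \<in> P \<Longrightarrow> a + b \<in> P"
    and mult: "\<And>a b. a \<in> P \<Longrightarrow> b \<in> P \<Longrightarrow> a * b \<in> P"
    and scalars: "\<And>c. c \<ge> 0 \<Longrightarrow> \<kappa> c \<in> P"
    and order_unit: "\<And>a. \<exists>r. \<kappa> r + a \<in> P"
    and f: "\<epsilon> > 0" "f + \<kappa> \<epsilon> \<notin> P"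
    and span: "spanning (range B)"
  obtains L where "character L" "\<forall>a\<in>P. 0 \<le> L a" "L f < 0"
proof -
  have up: "\<kappa> s - g \<in> P" if "\<kappa> r - g \<in> P" "r \<le> s" for r s g
    using add[OF that(1) scalars[of "s - r"]] that(2) by (simp add: scalar_diff)
  \<comment> \<open>Otherwise rescaling a negative constant cancels the order unit in
    \<open>\<kappa> r + f\<close> and puts \<open>f + \<kappa> \<epsilon>\<close> into
    \<open>P\<close>. Properness keeps the gauge \<open>p\<close> finite.\<close>
  have proper: "c \<ge> 0" if c: "\<kappa> c \<in> P" for c
  proof (rule ccontr)
    assume "\<not> c \<ge> 0"
    then have neg: "c < 0" by simp
    obtain r where r: "\<kappa> r + f \<in> P" using order_unit by blast
    have "\<kappa> (r / - c) * \<kappa> c \<in> P" if "r \<ge> 0"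
      using mult[OF scalars c] neg that by (simp add: divide_nonneg_neg)
    then have "\<kappa> (- max r 0) \<in> P"
      using neg scalars[of 0] by (cases "r \<ge> 0") (auto simp: scalar_mult[symmetric])
    from add[OF this r] have "\<kappa> (r - max r 0) + f \<in> P"
      by (simp add: scalar_diff scalar_minus algebra_simps)
    then have "\<kappa> (r - max r 0) + f + \<kappa> (max r 0 - r + \<epsilon>) \<in> P"
      by (rule add) (use f in \<open>auto intro!: scalars\<close>)
    then show False
      using f(2) by (simp add: scalar_diff scalar_add algebra_simps)
  qed
  define D where "D g = {r. \<kappa> r - g \<in> P}" for g
  define p where "p g = Inf (D g)" for g
  have D_ne: "D g \<noteq> {}" for g
    using order_unit[of "- g"] by (auto simp: D_def)
  have D_bdd: "bdd_below (D g)" for g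
  proof -
    obtain s where s: "\<kappa> s + g \<in> P" using order_unit by blast
    show ?thesis
    proof (rule bdd_belowI)
      fix r assume "r \<in> D g"
      then have "\<kappa> r + \<kappa> s \<in> P" using add[OF _ s, of "\<kappa> r - g"] by (simp add: D_def)
      then show "- s \<le> r" using proper[of "r + s"] by (simp add: scalar_add)
    qed
  qed
  have p_le: "p g \<le> r" if "\<kappa> r - g \<in> P" for g r
    unfolding p_def by (rule cInf_lower[OF _ D_bdd]) (use that in \<open>simp add: D_def\<close>)
  have p_ge: "b \<le> p g" if "\<And>r. \<kappa> r - g \<in> P \<Longrightarrow> b \<le> r" for g b
    unfolding p_def by (rule cInf_greatest[OF D_ne]) (use that in \<open>auto simp: D_def\<close>)
  have sub: "sublinear p"
  proof -
    have padd: "p (a + b) \<le> p a + p b" for a b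
    proof -
      have "p (a + b) - p b \<le> p a"
      proof (rule p_ge)
        fix r assume r: "\<kappa> r - a \<in> P"
        have "p (a + b) - r \<le> p b"
        proof (rule p_ge)
          fix s assume "\<kappa> s - b \<in> P"
          from add[OF r this] show "p (a + b) - r \<le> s"
            using p_le[of "r + s" "a + b"] by (simp add: scalar_add algebra_simps)
        qed
        then show "p (a + b) - p b \<le> r" by simp
      qed
      then show ?thesis by simp
    qed
    have le: "p (\<kappa> c * a) \<le> c * p a" if c: "c > 0" for c a
    proof -
      have "p (\<kappa> c * a) / c \<le> p a"
      proof (rule p_ge)
        fix r assume "\<kappa> r - a \<in> P"
        with mult[OF scalars[of c]] have "\<kappa> c * (\<kappa> r - a) \<in> P" using c by simp
        then have "p (\<kappa> c * a) \<le> c * r"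
          by (intro p_le) (simp add: scalar_mult algebra_simps)
        then show "p (\<kappa> c * a) / c \<le> r" using c by (simp add: field_simps)
      qed
      then show ?thesis using c by (simp add: field_simps)
    qed
    from padd le show ?thesis by (rule sublinearI)
  qed
  \<comment> \<open>Putting \<open>- f\<close> first makes the initial maximization give
    \<open>L (- f) = p (- f)\<close>; the sequence \<open>B\<close> follows and provides the
    spanning.\<close>
  define e where "e k = (case k of 0 \<Rightarrow> - f | Suc j \<Rightarrow> B j)" for k
  have "B j = e (Suc j)" for j by (simp add: e_def)
  then have "range B \<subseteq> range e" by auto
  with span have "spanning (range e)" by (rule spanning_mono)
  then obtain L where ext: "extreme_functional p L" and Lf: "L (e 0) = p (e 0)"
    using extreme_functional_exists[OF sub] by blast
  note L = extreme_functionalD(1)[OF ext] and Lp = extreme_functionalD(2)[OF ext]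
  note Ls = linear_functionalD[OF L]
  have pos: "0 \<le> L a" if "a \<in> P" for a
    using Lp[of "- a"] p_le[of 0 "- a"] that by (simp add: Ls)
  \<comment> \<open>Here \<open>p 1 \<le> 1\<close> and \<open>p (- 1) \<le> - 1\<close> give the
    two inequalities.\<close>
  have L1: "L 1 = 1"
    using Lp[of 1] Lp[of "- 1"] p_le[of 1 1] p_le[of "-1" "- 1"] scalars[of 0]
    by (simp add: Ls scalar_minus)
  have "\<epsilon> \<le> p (- f)"
  proof (rule p_ge)
    fix r assume r: "\<kappa> r - (- f) \<in> P"
    show "\<epsilon> \<le> r"
    proof (rule ccontr)
      assume "\<not> \<epsilon> \<le> r"
      with up[OF r, of \<epsilon>] f(2) show False by (simp add: add.commute)
    qed
  qed
  then have "L f < 0"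
    using Lf f(1) by (simp add: e_def Ls)
  have mult_unit: "L (g * h) = L g * L h" if g: "g \<in> P" "1 - g \<in> P" for g h
  proof (rule extreme_functionalD(3)[OF ext])
    \<comment> \<open>Positivity on \<open>g * (\<kappa> r - a)\<close> gives
      \<open>L (g * a) \<le> r * L g\<close> for every admissible \<open>r\<close>. Used for
      \<open>g\<close> and \<open>1 - g\<close>, it supplies the two dominations in the extremality
      condition with \<open>c = L g\<close>.\<close>
    have bound: "L (g * a) \<le> L g * p a" if g: "g \<in> P" for g a
    proof (cases "L g = 0")
      case True
      obtain r where "\<kappa> r - a \<in> P" using D_ne[of a] by (auto simp: D_def)
      from pos[OF mult[OF g this]] True show ?thesis
        by (simp add: Ls right_diff_distrib mult.commute[of g "\<kappa> r"])
    next
      case False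
      then have Lg: "L g > 0" using pos[OF g] by simp
      have "L (g * a) / L g \<le> p a"
      proof (rule p_ge)
        fix r assume "\<kappa> r - a \<in> P"
        from pos[OF mult[OF g this]] have "L (g * a) \<le> r * L g"
          by (simp add: Ls right_diff_distrib mult.commute[of g "\<kappa> r"])
        then show "L (g * a) / L g \<le> r" using Lg by (simp add: pos_divide_le_eq)
      qed
      then show ?thesis using Lg by (simp add: pos_divide_le_eq mult.commute)
    qed
    show "linear_functional (\<lambda>h. L (g * h))"
      by (simp add: linear_functional_def Ls distrib_left mult.left_commute[of g])
    show "L (g * a) \<le> L g * p a" for a by (rule bound[OF g(1)])
    show "L a - L (g * a) \<le> (1 - L g) * p a" for a
      using bound[OF g(2), of a] by (simp add: Ls L1 left_diff_distrib)
    show "0 \<le> L g" "L g \<le> 1" using pos[OF g(1)] pos[OF g(2)] by (auto simp: Ls L1)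
  qed
  have "L (g * h) = L g * L h" for g h
  proof -
    obtain r s where rs: "\<kappa> r + g \<in> P" "\<kappa> s - g \<in> P"
      using order_unit[of g] order_unit[of "- g"] by auto
    \<comment> \<open>The affine image \<open>u = (R + g) / (2 R)\<close> of \<open>g\<close> has
      both \<open>u\<close> and \<open>1 - u\<close> in \<open>P\<close>. Multiplicativity for
      \<open>u\<close> carries over to \<open>g\<close>, as the constant term 1/2 contributes
      equally to both sides.\<close>
    define R where "R = max 1 (max r s)"
    have R: "\<kappa> R + g \<in> P" "\<kappa> R - g \<in> P" "R > 0"
      using up[of r "- g" R] up[of s g R] rs by (auto simp: R_def)
    define u where "u = \<kappa> (1 / (2 * R)) * (\<kappa> R + g)"
    have "\<kappa> (1 / (2 * R)) * \<kappa> R = \<kappa> (1 / 2)"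
      using R by (simp add: scalar_mult[symmetric])
    then have u: "u = \<kappa> (1 / 2) + \<kappa> (1 / (2 * R)) * g"
      by (simp add: u_def distrib_left)
    have "1 = \<kappa> (1/2) + \<kappa> (1 / 2)" by (simp add: scalar_add[symmetric])
    then have "1 - u = \<kappa> (1 / (2 * R)) * (\<kappa> R - g)"
      using \<open>\<kappa> (1 / (2 * R)) * \<kappa> R = \<kappa> (1 / 2)\<close> by (simp add: u right_diff_distrib)
    then have "u \<in> P" "1 - u \<in> P"
      using R by (auto simp: u_def intro!: mult scalars)
    from mult_unit[OF this, of h] have "L (g * h) / (2 * R) = L g * L h / (2 * R)"
      by (simp add: u Ls L1 distrib_right mult.assoc)
    then show ?thesis using R by simp
  qed
  with L L1 pos \<open>L f < 0\<close> show thesis by (intro that[of L]) (auto simp: character_def)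
qed

end

section \<open>Submultiplicative norms\<close>

text \<open>By the triangle inequality, balls are open: around \<open>g\<close> the radius
  \<open>e - p (g - f)\<close> works. Conversely, the definition of the topology puts a ball inside
  every open neighbourhood.\<close>

lemma in_closure_of_seminorm_topology:
  assumes p0: "p 0 = 0" and triangle: "\<And>f g. p (f + g) \<le> p f + p g"
  shows "f \<in> seminorm_topology p closure_of S \<longleftrightarrow> (\<forall>e>0. \<exists>g\<in>S. p (g - f) < e)"
proof
  assume f: "f \<in> seminorm_topology p closure_of S"
  show "\<forall>e>0. \<exists>g\<in>S. p (g - f) < e"
  proof (intro allI impI)
    fix e :: real assume "e > 0"
    have "openin (seminorm_topology p) {g. p (g - f) < e}"
      unfolding openin_seminorm_topology
    proof
      fix g assume g: "g \<in> {g. p (g - f) < e}"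
      have "p (h - f) < e" if "p (h - g) < e - p (g - f)" for h
        using triangle[of "h - g" "g - f"] that by simp
      with g show "\<exists>d>0. \<forall>h. p (h - g) < d \<longrightarrow> h \<in> {g. p (g - f) < e}"
        by (intro exI[of _ "e - p (g - f)"]) auto
    qed
    moreover have "f \<in> {g. p (g - f) < e}"
      using p0 \<open>e > 0\<close> by simp
    ultimately have "\<exists>g. g \<in> S \<and> g \<in> {g. p (g - f) < e}"
      by (intro f[unfolded in_closure_of, THEN conjunct2, rule_format] conjI)
    then show "\<exists>g\<in>S. p (g - f) < e" by auto
  qed
next
  assume f: "\<forall>e>0. \<exists>g\<in>S. p (g - f) < e"
  show "f \<in> seminorm_topology p closure_of S"
    unfolding in_closure_of
  proof (intro conjI allI impI)
    fix U assume "f \<in> U \<and> openin (seminorm_topology p) U"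
    then have U: "f \<in> U" "\<forall>f\<in>U. \<exists>e>0. \<forall>g. p (g - f) < e \<longrightarrow> g \<in> U"
      by (simp_all add: openin_seminorm_topology)
    obtain e where e: "e > 0" "\<forall>g. p (g - f) < e \<longrightarrow> g \<in> U"
      using bspec[OF U(2,1)] by auto
    obtain g where "g \<in> S" "p (g - f) < e"
      using f[rule_format, OF e(1)] by auto
    with e(2) show "\<exists>y. y \<in> S \<and> y \<in> U" by auto
  qed simp
qed

locale submultiplicative_norm = real_scalars \<kappa> for \<kappa> :: "real \<Rightarrow> 'a::comm_ring_1" +
  fixes N :: "'a \<Rightarrow> real"
  assumes norm_nonneg [simp]: "0 \<le> N a"
    and norm_eq_0 [simp]: "N a = 0 \<longleftrightarrow> a = 0"
    and norm_add: "N (a + b) \<le> N a + N b"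
    and norm_scale: "N (\<kappa> c * a) = \<bar>c\<bar> * N a"
    and norm_mult: "N (a * b) \<le> N a * N b"
begin

lemma norm_0 [simp]: "N 0 = 0"
  by (subst norm_eq_0) rule

lemma norm_pos: "a \<noteq> 0 \<Longrightarrow> 0 < N a"
  by (simp add: less_le)

lemma norm_minus [simp]: "N (- a) = N a"
  using norm_scale[of "-1" a] by (simp add: scalar_minus)

lemma norm_minus_commute: "N (a - b) = N (b - a)"
  using norm_minus[of "a - b"] by simp

lemma norm_diff: "N (a - b) \<le> N a + N b"
  using norm_add[of a "- b"] by simp

lemma norm_of_nat_mult: "N (of_nat k * a) = real k * N a"
  using norm_scale[of "real k" a] by (simp add: scalar_of_nat)

lemma norm_mult_le: "N a \<le> x \<Longrightarrow> N b \<le> y \<Longrightarrow> N (a * b) \<le> x * y"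
  by (rule order_trans[OF norm_mult mult_mono]) (auto intro: order_trans[OF norm_nonneg])

text \<open>The exponent is positive because \<open>N 1\<close> may exceed 1.\<close>

lemma norm_power: "k > 0 \<Longrightarrow> N (a ^ k) \<le> N a ^ k"
proof (induction k rule: nat_induct_non_zero)
  case (Suc k)
  then show ?case using norm_mult_le[of a "N a" "a ^ k" "N a ^ k"] by simp
qed simp

text \<open>Strict differentiability at 0 with derivative 0.\<close>

definition flat :: "('a \<Rightarrow> 'a) \<Rightarrow> bool" where
  "flat G \<longleftrightarrow> (\<forall>\<delta>>0. \<exists>\<rho>>0. \<forall>u v. N u \<le> \<rho> \<longrightarrow> N v \<le> \<rho> \<longrightarrow> N (G u - G v) \<le> \<delta> * N (u - v))"

lemma flatE:
  assumes "flat G" "\<delta> > 0"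
  obtains \<rho> where "\<rho> > 0" "\<And>u v. N u \<le> \<rho> \<Longrightarrow> N v \<le> \<rho> \<Longrightarrow> N (G u - G v) \<le> \<delta> * N (u - v)"
proof -
  obtain \<rho> where "\<rho> > 0" "\<forall>u v. N u \<le> \<rho> \<longrightarrow> N v \<le> \<rho> \<longrightarrow> N (G u - G v) \<le> \<delta> * N (u - v)"
    using assms unfolding flat_def by blast
  then show thesis by (intro that) auto
qed

lemma flat_add:
  assumes "flat G" "flat H"
  shows "flat (\<lambda>u. G u + H u)"
  unfolding flat_def
proof (intro allI impI)
  fix \<delta> :: real assume "\<delta> > 0"
  then have half: "\<delta> / 2 > 0" by simp
  obtain \<rho> where \<rho>: "\<rho> > 0"
      "\<And>u v. N u \<le> \<rho> \<Longrightarrow> N v \<le> \<rho> \<Longrightarrow> N (G u - G v) \<le> \<delta> / 2 * N (u - v)"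
    by (rule flatE[OF assms(1) half]) (rule that)
  obtain \<sigma> where \<sigma>: "\<sigma> > 0"
      "\<And>u v. N u \<le> \<sigma> \<Longrightarrow> N v \<le> \<sigma> \<Longrightarrow> N (H u - H v) \<le> \<delta> / 2 * N (u - v)"
    by (rule flatE[OF assms(2) half]) (rule that)
  have "N (G u + H u - (G v + H v)) \<le> \<delta> * N (u - v)"
    if "N u \<le> min \<rho> \<sigma>" "N v \<le> min \<rho> \<sigma>" for u v
  proof -
    have "G u + H u - (G v + H v) = (G u - G v) + (H u - H v)" by simp
    then show ?thesis
      using norm_add[of "G u - G v" "H u - H v"] \<rho>(2)[of u v] \<sigma>(2)[of u v] that
      by (simp add: field_simps)
  qed
  then show "\<exists>\<rho>>0. \<forall>u v. N u \<le> \<rho> \<longrightarrow> N v \<le> \<rho> \<longrightarrow> N (G u + H u - (G v + H v)) \<le> \<delta> * N (u - v)"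
    using \<rho>(1) \<sigma>(1) by (intro exI[of _ "min \<rho> \<sigma>"]) auto
qed

text \<open>In \<open>(u - v) * G u + v * (G u - G v)\<close> the Lipschitz constant 1 for
  \<open>G\<close> is enough: the small factor comes from \<open>N v\<close> and from
  \<open>N (G u) \<le> N u\<close>, both at most \<open>\<delta> / 2\<close>.\<close>

lemma flat_mult_left:
  assumes "flat G" "G 0 = 0"
  shows "flat (\<lambda>u. u * G u)"
  unfolding flat_def
proof (intro allI impI)
  fix \<delta> :: real assume \<delta>: "\<delta> > 0"
  obtain \<rho> where \<rho>: "\<rho> > 0" "\<And>u v. N u \<le> \<rho> \<Longrightarrow> N v \<le> \<rho> \<Longrightarrow> N (G u - G v) \<le> 1 * N (u - v)"
    by (rule flatE[OF assms(1) zero_less_one]) (rule that)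
  define \<sigma> where "\<sigma> = min \<rho> (\<delta> / 2)"
  have "N (u * G u - v * G v) \<le> \<delta> * N (u - v)" if uv: "N u \<le> \<sigma>" "N v \<le> \<sigma>" for u v
  proof -
    have "N (G u) \<le> \<delta> / 2"
      using \<rho>(2)[of u 0] uv \<rho>(1) assms(2) by (simp add: \<sigma>_def)
    then have "N ((u - v) * G u) \<le> N (u - v) * (\<delta> / 2)"
      by (rule norm_mult_le[OF order_refl])
    moreover have "N (v * (G u - G v)) \<le> \<delta> / 2 * N (u - v)"
      using \<rho>(2)[of u v] uv by (intro norm_mult_le) (simp_all add: \<sigma>_def)
    moreover have "u * G u - v * G v = (u - v) * G u + v * (G u - G v)"
      by (simp add: algebra_simps)
    ultimately show ?thesis
      using norm_add[of "(u - v) * G u" "v * (G u - G v)"] by (simp add: field_simps)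
  qed
  then show "\<exists>\<rho>>0. \<forall>u v. N u \<le> \<rho> \<longrightarrow> N v \<le> \<rho> \<longrightarrow> N (u * G u - v * G v) \<le> \<delta> * N (u - v)"
    using \<rho>(1) \<delta> by (intro exI[of _ \<sigma>]) (auto simp: \<sigma>_def)
qed

text \<open>The difference factors through \<open>(u + v) * (u - v)\<close>, whose first factor is
  small near 0.\<close>

lemma flat_square: "flat (\<lambda>u. of_nat k * (u * u))"
  unfolding flat_def
proof (intro allI impI)
  fix \<delta> :: real assume \<delta>: "\<delta> > 0"
  define \<rho> where "\<rho> = \<delta> / (2 * (real k + 1))"
  have \<rho>: "\<rho> > 0" "real k * (2 * \<rho>) \<le> \<delta>" using \<delta> by (simp_all add: \<rho>_def field_simps)
  have "N (of_nat k * (u * u) - of_nat k * (v * v)) \<le> \<delta> * N (u - v)" if uv: "N u \<le> \<rho>" "N v \<le> \<rho>" for u v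
  proof -
    have "of_nat k * (u * u) - of_nat k * (v * v) = of_nat k * ((u + v) * (u - v))"
      by (simp add: algebra_simps)
    then have "N (of_nat k * (u * u) - of_nat k * (v * v)) = real k * N ((u + v) * (u - v))"
      by (simp only: norm_of_nat_mult)
    also have "N ((u + v) * (u - v)) \<le> 2 * \<rho> * N (u - v)"
      using norm_add[of u v] uv by (intro norm_mult_le) auto
    finally have "N (of_nat k * (u * u) - of_nat k * (v * v)) \<le> real k * (2 * \<rho> * N (u - v))"
      by (simp add: mult_left_mono)
    also have "\<dots> \<le> \<delta> * N (u - v)"
      using mult_right_mono[OF \<rho>(2) norm_nonneg[of "u - v"]] by (simp add: mult.assoc)
    finally show ?thesis .
  qed
  then show "\<exists>\<rho>>0. \<forall>u v. N u \<le> \<rho> \<longrightarrow> N v \<le> \<rho> \<longrightarrow> N (of_nat k * (u * u) - of_nat k * (v * v)) \<le> \<delta> * N (u - v)"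
    using \<rho>(1) by blast
qed

text \<open>If \<open>G\<close> is the remainder for exponent \<open>k\<close>, the one for
  \<open>Suc k\<close> is \<open>G u + u * G u + k u^2\<close>, so flatness follows by induction
  from the sum, product and square rules.\<close>

lemma flat_power: "flat (\<lambda>u. (1 + u) ^ k - 1 - of_nat k * u)"
proof (induction k)
  case 0
  have "\<exists>\<rho>::real. \<rho> > 0" by (rule exI[of _ 1]) simp
  then show ?case by (auto simp: flat_def)
next
  case (Suc k)
  define G where "G u = (1 + u) ^ k - 1 - of_nat k * u" for u :: 'a
  have "flat G" using Suc by (simp add: G_def[abs_def])
  moreover have "G 0 = 0" by (simp add: G_def)
  ultimately have "flat (\<lambda>u. (G u + u * G u) + of_nat k * (u * u))"
    by (intro flat_add flat_mult_left flat_square)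
  moreover have "(G u + u * G u) + of_nat k * (u * u) = (1 + u) ^ Suc k - 1 - of_nat (Suc k) * u" for u
    by (simp add: G_def algebra_simps)
  ultimately show ?case by simp
qed

text \<open>The \<open>k\<close>-th root of \<open>1 + g\<close> need not exist without completeness, but the contraction
  \<open>u \<mapsto> (g - q u) / k\<close> with \<open>q u = (1 + u)\<^sup>k - 1 - k u\<close> still provides approximate roots.\<close>

lemma approximate_roots:
  assumes k: "k > 0"
  obtains \<eta> where "\<eta> > 0" "\<And>g \<epsilon>. N g \<le> \<eta> \<Longrightarrow> \<epsilon> > 0 \<Longrightarrow> \<exists>u. N ((1 + u) ^ k - (1 + g)) < \<epsilon>"
proof -
  define q where "q u = (1 + u) ^ k - 1 - of_nat k * u" for u :: 'a
  have "flat q" using flat_power[of k] by (simp add: q_def[abs_def])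
  \<comment> \<open>The constant 1/2 makes \<open>q\<close> a contraction on the
    \<open>\<rho>\<close>-ball. For \<open>N g \<le> \<rho> / 2\<close> each iterate then has norm
    at most \<open>\<rho> / 2 + \<rho> / 2\<close>, so the iteration stays in that ball.\<close>
  then obtain \<rho> where \<rho>: "\<rho> > 0" "\<And>u v. N u \<le> \<rho> \<Longrightarrow> N v \<le> \<rho> \<Longrightarrow> N (q u - q v) \<le> 1/2 * N (u - v)"
    by (rule flatE[OF _ half_gt_zero[OF zero_less_one]]) (rule that)
  have q0: "q 0 = 0" by (simp add: q_def)
  have shrink: "N (\<kappa> (1 / real k) * a) \<le> N a" for a
    using k mult_left_le_one_le[of "N a" "1 / real k"] by (simp add: norm_scale)
  have "\<exists>u. N ((1 + u) ^ k - (1 + g)) < \<epsilon>" if g: "N g \<le> \<rho> / 2" and \<epsilon>: "\<epsilon> > 0" for g \<epsilon>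
  proof -
    define u where "u n = ((\<lambda>v. \<kappa> (1 / real k) * (g - q v)) ^^ n) 0" for n
    have u0: "u 0 = 0" and uS: "u (Suc n) = \<kappa> (1 / real k) * (g - q (u n))" for n
      by (simp_all add: u_def)
    have u\<rho>: "N (u n) \<le> \<rho>" for n
    proof (induction n)
      case 0
      then show ?case using \<rho>(1) by (simp add: u0)
    next
      case (Suc n)
      have "N (u (Suc n)) \<le> N g + N (q (u n))"
        unfolding uS by (rule order_trans[OF shrink norm_diff])
      also have "\<dots> \<le> \<rho>"
        using g \<rho>(2)[of "u n" 0] Suc \<rho>(1) by (simp add: q0)
      finally show ?case .
    qed
    have step: "N (u (Suc n) - u n) \<le> (1/2) ^ n * N (u 1)" for n
    proof (induction n)
      case 0
      then show ?case by (simp add: u0)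
    next
      case (Suc n)
      have "u (Suc (Suc n)) - u (Suc n) = \<kappa> (1 / real k) * (q (u n) - q (u (Suc n)))"
        by (simp add: uS algebra_simps)
      then have "N (u (Suc (Suc n)) - u (Suc n)) \<le> N (q (u n) - q (u (Suc n)))"
        using shrink by simp
      also have "\<dots> \<le> 1/2 * N (u (Suc n) - u n)"
        using \<rho>(2)[OF u\<rho> u\<rho>, of n "Suc n"] by (simp add: norm_minus_commute)
      finally show ?case using Suc by simp
    qed
    \<comment> \<open>The defect of the \<open>n\<close>-th iterate as a root is exactly
      \<open>k\<close> times the next step \<open>u n - u (Suc n)\<close>, which decays
      geometrically; no limit of the iterates enters.\<close>
    have residual: "N ((1 + u n) ^ k - (1 + g)) \<le> real k * ((1/2) ^ n * N (u 1))" for n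
    proof -
      have "of_nat k * u (Suc n) = g - q (u n)"
        using k scalar_inverse_cancel(1)[of "real k" "g - q (u n)"] by (simp add: uS scalar_of_nat)
      then have "(1 + u n) ^ k - (1 + g) = of_nat k * (u n - u (Suc n))"
        by (simp add: q_def algebra_simps)
      then show ?thesis
        using step[of n] by (simp add: norm_of_nat_mult norm_minus_commute mult_left_mono)
    qed
    have "(\<lambda>n. real k * ((1/2) ^ n * N (u 1))) \<longlonglongrightarrow> real k * (0 * N (u 1))"
      by (intro tendsto_intros LIMSEQ_power_zero) simp
    then have "\<forall>\<^sub>F n in sequentially. real k * ((1/2) ^ n * N (u 1)) < \<epsilon>"
      by (rule order_tendstoD(2)) (use \<epsilon> in simp)
    then obtain n where "real k * ((1/2) ^ n * N (u 1)) < \<epsilon>"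
      by (auto simp: eventually_sequentially)
    with residual[of n] show ?thesis by (meson order_le_less_trans)
  qed
  then show thesis using that[of "\<rho> / 2"] \<rho>(1) by simp
qed

section \<open>Closures in the norm topology and their algebraic structure\<close>

lemma in_norm_closure_iff:
  "f \<in> seminorm_topology N closure_of S \<longleftrightarrow> (\<forall>e>0. \<exists>g\<in>S. N (g - f) < e)"
  by (rule in_closure_of_seminorm_topology) (simp_all add: norm_add)

lemma in_norm_closure_sequential:
  "f \<in> seminorm_topology N closure_of S \<longleftrightarrow> (\<exists>s. (\<forall>n. s n \<in> S) \<and> (\<lambda>n. N (s n - f)) \<longlonglongrightarrow> 0)"
proof
  assume "f \<in> seminorm_topology N closure_of S"
  then have "\<forall>n. \<exists>g\<in>S. N (g - f) < inverse (real (Suc n))"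
    by (simp add: in_norm_closure_iff)
  then obtain s where s: "\<And>n. s n \<in> S" "\<And>n. N (s n - f) < inverse (real (Suc n))"
    by metis
  have "(\<lambda>n. N (s n - f)) \<longlonglongrightarrow> 0"
    by (rule tendsto_sandwich[OF _ _ tendsto_const LIMSEQ_inverse_real_of_nat])
      (use s(2) in \<open>auto intro!: always_eventually less_imp_le\<close>)
  with s(1) show "\<exists>s. (\<forall>n. s n \<in> S) \<and> (\<lambda>n. N (s n - f)) \<longlonglongrightarrow> 0" by blast
next
  assume "\<exists>s. (\<forall>n. s n \<in> S) \<and> (\<lambda>n. N (s n - f)) \<longlonglongrightarrow> 0"
  then obtain s where s: "\<And>n. s n \<in> S" "(\<lambda>n. N (s n - f)) \<longlonglongrightarrow> 0" by blast
  show "f \<in> seminorm_topology N closure_of S"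
    unfolding in_norm_closure_iff
  proof (intro allI impI)
    fix e :: real assume "e > 0"
    then obtain n where "N (s n - f) < e"
      using order_tendstoD(2)[OF s(2)] by (auto simp: eventually_sequentially)
    with s(1) show "\<exists>g\<in>S. N (g - f) < e" by blast
  qed
qed

lemma norm_tendsto_0:
  assumes "b \<longlonglongrightarrow> 0" "\<And>n. N (a n) \<le> b n"
  shows "(\<lambda>n. N (a n)) \<longlonglongrightarrow> 0"
  by (rule tendsto_sandwich[OF _ _ tendsto_const assms(1)]) (use assms(2) in auto)

lemma closure_of_add:
  assumes S: "\<And>a b. a \<in> S \<Longrightarrow> b \<in> S \<Longrightarrow> a + b \<in> S"
    and ab: "a \<in> seminorm_topology N closure_of S" "b \<in> seminorm_topology N closure_of S"
  shows "a + b \<in> seminorm_topology N closure_of S"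
proof -
  obtain s t where s: "\<And>n. s n \<in> S" "(\<lambda>n. N (s n - a)) \<longlonglongrightarrow> 0"
    and t: "\<And>n. t n \<in> S" "(\<lambda>n. N (t n - b)) \<longlonglongrightarrow> 0"
    using ab unfolding in_norm_closure_sequential by blast
  have "(\<lambda>n. N (s n + t n - (a + b))) \<longlonglongrightarrow> 0"
  proof (rule norm_tendsto_0)
    show "(\<lambda>n. N (s n - a) + N (t n - b)) \<longlonglongrightarrow> 0"
      using tendsto_add[OF s(2) t(2)] by simp
    show "N (s n + t n - (a + b)) \<le> N (s n - a) + N (t n - b)" for n
      using norm_add[of "s n - a" "t n - b"] by (simp add: algebra_simps)
  qed
  with S s(1) t(1) show ?thesis
    unfolding in_norm_closure_sequential by (intro exI[of _ "\<lambda>n. s n + t n"]) auto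
qed

lemma closure_of_mult:
  assumes S: "\<And>a b. a \<in> S \<Longrightarrow> b \<in> S \<Longrightarrow> a * b \<in> S"
    and ab: "a \<in> seminorm_topology N closure_of S" "b \<in> seminorm_topology N closure_of S"
  shows "a * b \<in> seminorm_topology N closure_of S"
proof -
  obtain s t where s: "\<And>n. s n \<in> S" "(\<lambda>n. N (s n - a)) \<longlonglongrightarrow> 0"
    and t: "\<And>n. t n \<in> S" "(\<lambda>n. N (t n - b)) \<longlonglongrightarrow> 0"
    using ab unfolding in_norm_closure_sequential by blast
  \<comment> \<open>Expanding around both limits leaves only the fixed factors \<open>N a\<close>
    and \<open>N b\<close>, so no bound on the approximating sequences is required.\<close>
  let ?b = "\<lambda>n. N (s n - a) * N (t n - b) + N (s n - a) * N b + N a * N (t n - b)"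
  have "(\<lambda>n. N (s n * t n - a * b)) \<longlonglongrightarrow> 0"
  proof (rule norm_tendsto_0)
    have "?b \<longlonglongrightarrow> 0 * 0 + 0 * N b + N a * 0"
      by (intro tendsto_intros s t)
    then show "?b \<longlonglongrightarrow> 0" by simp
    show "N (s n * t n - a * b) \<le> ?b n" for n
    proof -
      have "s n * t n - a * b = ((s n - a) * (t n - b) + (s n - a) * b) + a * (t n - b)"
        by (simp add: algebra_simps)
      then show ?thesis
        using norm_add[of "(s n - a) * (t n - b) + (s n - a) * b" "a * (t n - b)"]
          norm_add[of "(s n - a) * (t n - b)" "(s n - a) * b"]
          norm_mult[of "s n - a" "t n - b"] norm_mult[of "s n - a" b] norm_mult[of a "t n - b"]
        by simp
    qed
  qed
  with S s(1) t(1) show ?thesis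
    unfolding in_norm_closure_sequential by (intro exI[of _ "\<lambda>n. s n * t n"]) auto
qed

text \<open>The constant \<open>\<epsilon>\<close> has norm \<open>\<epsilon> * N 1\<close>, which
  tends to 0. Read contrapositively, a point outside the closure stays outside after adding some
  positive constant, which is the margin that a strictly separating character requires.\<close>

lemma closure_of_shift:
  assumes "\<And>\<epsilon>. \<epsilon> > 0 \<Longrightarrow> f + \<kappa> \<epsilon> \<in> seminorm_topology N closure_of S"
  shows "f \<in> seminorm_topology N closure_of S"
  unfolding in_norm_closure_iff
proof (intro allI impI)
  fix e :: real assume e: "e > 0"
  define \<epsilon> where "\<epsilon> = e / (2 * (N 1 + 1))"
  have N1: "N 1 + 1 > 0" using norm_nonneg[of 1] by linarith
  then have \<epsilon>: "\<epsilon> > 0" "\<epsilon> * N 1 \<le> e / 2"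
    using e by (simp_all add: \<epsilon>_def field_simps)
  have "e / 2 > 0" using e by simp
  then obtain g where g: "g \<in> S" "N (g - (f + \<kappa> \<epsilon>)) < e / 2"
    using assms[OF \<epsilon>(1)] unfolding in_norm_closure_iff by blast
  have "N (g - f) \<le> N (g - (f + \<kappa> \<epsilon>)) + N (\<kappa> \<epsilon> * 1)"
    using norm_add[of "g - (f + \<kappa> \<epsilon>)" "\<kappa> \<epsilon>"] by simp
  also have "\<dots> < e"
    using g(2) \<epsilon> by (simp only: norm_scale)
  finally show "\<exists>g\<in>S. N (g - f) < e" using g(1) by blast
qed

text \<open>Approximate \<open>k\<close>-th roots place a ball around 1 in the closure of
  \<open>S\<close>. This ball makes 1 an order unit, so a positive character exists, and the same
  order-unit estimate bounds the character by a multiple of the norm.\<close>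

lemma separating_character_exists:
  fixes B :: "nat \<Rightarrow> 'a"
  assumes add: "\<And>a b. a \<in> S \<Longrightarrow> b \<in> S \<Longrightarrow> a + b \<in> S"
    and mult: "\<And>a b. a \<in> S \<Longrightarrow> b \<in> S \<Longrightarrow> a * b \<in> S"
    and scalars: "\<And>c. c \<ge> 0 \<Longrightarrow> \<kappa> c \<in> S"
    and powers: "k > 0" "\<And>a. a ^ k \<in> S"
    and f: "f \<notin> seminorm_topology N closure_of S"
    and span: "spanning (range B)"
  obtains L C where "character L" "\<forall>a. \<bar>L a\<bar> \<le> C * N a" "L f < 0"
proof -
  define P where "P = seminorm_topology N closure_of S"
  have addP: "a + b \<in> P" if "a \<in> P" "b \<in> P" for a b
    using closure_of_add[OF add] that by (simp add: P_def)
  have multP: "a * b \<in> P" if "a \<in> P" "b \<in> P" for a b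
    using closure_of_mult[OF mult] that by (simp add: P_def)
  have scalP: "\<kappa> c \<in> P" if "c \<ge> 0" for c
    using closure_of_subset[of S "seminorm_topology N"] scalars[OF that] by (auto simp: P_def)
  obtain \<eta> where \<eta>: "\<eta> > 0" "\<And>g \<epsilon>. N g \<le> \<eta> \<Longrightarrow> \<epsilon> > 0 \<Longrightarrow> \<exists>u. N ((1 + u) ^ k - (1 + g)) < \<epsilon>"
    by (rule approximate_roots[OF powers(1)]) (rule that)
  have unit: "1 + g \<in> P" if "N g \<le> \<eta>" for g
    unfolding P_def in_norm_closure_iff using \<eta>(2)[OF that] powers(2) by meson
  define C where "C = 1 / \<eta>"
  have C: "C > 0" using \<eta>(1) by (simp add: C_def)
  \<comment> \<open>Dividing \<open>a\<close> by \<open>C * N a\<close> gives norm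
    \<open>\<eta>\<close>, exactly the radius of the ball around 1; multiplying back by a
    nonnegative constant stays in \<open>P\<close>.\<close>
  have order_unit: "\<kappa> (C * N a) + a \<in> P" for a
  proof (cases "a = 0")
    case True
    then show ?thesis using scalP[of 0] by simp
  next
    case False
    then have Na: "N a > 0" by (rule norm_pos)
    have "1 + \<kappa> (1 / (C * N a)) * a \<in> P"
      using Na C by (intro unit) (simp add: norm_scale C_def)
    then have "\<kappa> (C * N a) * (1 + \<kappa> (1 / (C * N a)) * a) \<in> P"
      using C by (intro multP scalP) auto
    moreover have "\<kappa> (C * N a) * (\<kappa> (1 / (C * N a)) * a) = a"
      by (rule scalar_inverse_cancel) (use False C in simp)
    ultimately show ?thesis by (simp only: distrib_left mult_1_right)
  qed
  obtain \<epsilon> where \<epsilon>: "\<epsilon> > 0" "f + \<kappa> \<epsilon> \<notin> P"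
    using closure_of_shift f by (auto simp: P_def)
  have "\<exists>r. \<kappa> r + a \<in> P" for a using order_unit by blast
  then obtain L where L: "character L" "\<forall>a\<in>P. 0 \<le> L a" "L f < 0"
    using positive_character_exists[OF addP multP scalP _ \<epsilon> span] by blast
  then have lin: "linear_functional L" and L1: "L 1 = 1"
    by (auto simp: character_def)
  \<comment> \<open>Positivity at \<open>\<kappa> (C * N a) + a\<close> and at
    \<open>\<kappa> (C * N a) - a\<close> gives the two sides of the bound.\<close>
  have "\<bar>L a\<bar> \<le> C * N a" for a
    using bspec[OF L(2) order_unit[of a]] bspec[OF L(2) order_unit[of "- a"]]
    by (simp add: linear_functionalD[OF lin] L1 abs_le_iff)
  with L show thesis by (intro that) auto
qed

text \<open>Applying the bound to all powers of \<open>a\<close> removes the constant.\<close>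

lemma character_le_norm:
  assumes char: "character L" and bound: "\<And>a. \<bar>L a\<bar> \<le> C * N a"
  shows "\<bar>L a\<bar> \<le> N a"
proof (rule ccontr)
  assume "\<not> \<bar>L a\<bar> \<le> N a"
  then have less: "N a < \<bar>L a\<bar>" by simp
  have Lpow: "L (a ^ k) = L a ^ k" for k
    by (induction k) (use char in \<open>simp_all add: character_def\<close>)
  have "a \<noteq> 0" using less bound[of a] by auto
  then have Na: "N a > 0" by (rule norm_pos)
  have C0: "C \<ge> 0"
    using order_trans[OF abs_ge_zero bound[of a]] Na by (simp add: zero_le_mult_iff)
  have gt1: "1 < \<bar>L a\<bar> / N a"
    using less Na by (simp add: less_divide_eq)
  then obtain n where n: "C < (\<bar>L a\<bar> / N a) ^ n"
    using real_arch_pow by blast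
  \<comment> \<open>Passing to \<open>Suc n\<close> ensures the positive exponent that
    \<open>norm_power\<close> requires.\<close>
  also have "\<dots> \<le> (\<bar>L a\<bar> / N a) ^ Suc n"
    by (rule power_increasing) (use gt1 in simp_all)
  also have "\<dots> \<le> C"
  proof -
    have "\<bar>L a\<bar> ^ Suc n \<le> C * N (a ^ Suc n)"
      using bound[of "a ^ Suc n"] by (simp only: Lpow power_abs)
    also have "\<dots> \<le> C * N a ^ Suc n"
      using norm_power[of "Suc n" a] C0 by (intro mult_left_mono) auto
    finally show ?thesis
      using Na unfolding power_divide by (subst pos_divide_le_eq) auto
  qed
  finally show False by simp
qed

text \<open>Translates membership in the Gelfand spectrum into a norm bound: a ball inside the
  preimage of (-1, 1) gives the constant by rescaling, and a bound makes \<open>L\<close>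
  Lipschitz.\<close>

lemma continuous_linear_functional_iff:
  assumes L: "linear_functional L"
  shows "continuous_map (seminorm_topology N) euclideanreal L \<longleftrightarrow> (\<exists>C. \<forall>a. \<bar>L a\<bar> \<le> C * N a)"
proof
  assume "continuous_map (seminorm_topology N) euclideanreal L"
  then have "openin (seminorm_topology N) {a. L a \<in> {-1<..<1}}"
    using openin_continuous_map_preimage[of "seminorm_topology N" euclideanreal L "{-1<..<1}"]
    by simp
  moreover have "0 \<in> {a. L a \<in> {-1<..<1}}"
    by (simp add: linear_functionalD[OF L])
  ultimately obtain e where e: "e > 0" "\<And>a. N a < e \<Longrightarrow> \<bar>L a\<bar> < 1"
    unfolding openin_seminorm_topology by (force simp: abs_less_iff)
  have "\<bar>L a\<bar> \<le> 2 / e * N a" for a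
  proof (cases "a = 0")
    case True
    then show ?thesis by (simp add: linear_functionalD[OF L])
  next
    case False
    then have Na: "N a > 0" by (rule norm_pos)
    define c where "c = e / (2 * N a)"
    have c: "c > 0" "c * N a < e" using e(1) Na by (simp_all add: c_def)
    then have "c * \<bar>L a\<bar> < 1"
      using e(2)[of "\<kappa> c * a"] by (simp add: norm_scale linear_functionalD[OF L] abs_mult)
    then show ?thesis using e(1) Na by (simp add: c_def field_simps)
  qed
  then show "\<exists>C. \<forall>a. \<bar>L a\<bar> \<le> C * N a" by blast
next
  assume "\<exists>C. \<forall>a. \<bar>L a\<bar> \<le> C * N a"
  then obtain C where C: "\<And>a. \<bar>L a\<bar> \<le> C * N a" by blast
  \<comment> \<open>A strictly positive constant permits the radius \<open>d / D\<close>.\<close>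
  define D where "D = max C 1"
  have D: "D > 0" "\<bar>L a\<bar> \<le> D * N a" for a
    using C[of a] mult_right_mono[of C D "N a"] by (auto simp: D_def)
  show "continuous_map (seminorm_topology N) euclideanreal L"
    unfolding continuous_map_def
  proof (intro conjI allI impI)
    fix U :: "real set" assume "openin euclideanreal U"
    then have U: "open U" by simp
    show "openin (seminorm_topology N) {a \<in> topspace (seminorm_topology N). L a \<in> U}"
      unfolding openin_seminorm_topology
    proof
      fix a assume "a \<in> {a \<in> topspace (seminorm_topology N). L a \<in> U}"
      then obtain d where d: "d > 0" "\<And>y. dist y (L a) < d \<Longrightarrow> y \<in> U"
        using U by (auto simp: open_dist)
      have "L b \<in> U" if "N (b - a) < d / D" for b
      proof (rule d(2))
        have "\<bar>L b - L a\<bar> \<le> D * N (b - a)"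
          using D(2)[of "b - a"] by (simp add: linear_functionalD[OF L])
        also have "\<dots> < d" using that D(1) by (simp add: field_simps)
        finally show "dist (L b) (L a) < d" by (simp add: dist_real_def)
      qed
      then show "\<exists>e>0. \<forall>b. N (b - a) < e \<longrightarrow> b \<in> {a \<in> topspace (seminorm_topology N). L a \<in> U}"
        using d(1) D(1) by (intro exI[of _ "d / D"]) auto
    qed
  qed auto
qed

end

section \<open>Characters and power sums of polynomials\<close>

definition monomial_eval :: "real ^ 'n::finite \<Rightarrow> ('n \<Rightarrow>\<^sub>0 nat) \<Rightarrow> real" where
  "monomial_eval x m = (\<Prod>i\<in>UNIV. (x $ i) ^ Poly_Mapping.lookup m i)"

lemma monomial_eval_0 [simp]: "monomial_eval x 0 = 1"
  by (simp add: monomial_eval_def)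

lemma monomial_eval_add: "monomial_eval x (m + m') = monomial_eval x m * monomial_eval x m'"
  by (simp add: monomial_eval_def lookup_add power_add prod.distrib)

text \<open>Cancellation can shrink the support of a sum; a common larger index set makes
  evaluations of different polynomials comparable term by term.\<close>

lemma poly_eval_superset:
  assumes "finite A" "Poly_Mapping.keys f \<subseteq> A"
  shows "poly_eval x f = (\<Sum>m\<in>A. Poly_Mapping.lookup f m * monomial_eval x m)"
  unfolding poly_eval_def monomial_eval_def
  by (rule sum.mono_neutral_left) (use assms in \<open>auto simp: in_keys_iff\<close>)

lemma poly_eval_add: "poly_eval x (f + g) = poly_eval x f + poly_eval x g"
proof -
  let ?A = "Poly_Mapping.keys f \<union> Poly_Mapping.keys g"
  have "poly_eval x h = (\<Sum>m\<in>?A. Poly_Mapping.lookup h m * monomial_eval x m)"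
    if "h \<in> {f, g, f + g}" for h
    using that keys_add[of f g] by (intro poly_eval_superset) auto
  then show ?thesis by (simp add: lookup_add distrib_right sum.distrib)
qed

lemma poly_eval_0 [simp]: "poly_eval x 0 = 0"
  by (simp add: poly_eval_def)

lemma poly_eval_sum: "poly_eval x (\<Sum>i\<in>I. f i) = (\<Sum>i\<in>I. poly_eval x (f i))"
  by (induction I rule: infinite_finite_induct) (simp_all add: poly_eval_add)

lemma poly_eval_single: "poly_eval x (Poly_Mapping.single m a) = a * monomial_eval x m"
  using poly_eval_superset[of "{m}" "Poly_Mapping.single m a" x] by simp

lemma poly_mapping_eq_sum_single:
  "f = (\<Sum>m\<in>Poly_Mapping.keys f. Poly_Mapping.single m (Poly_Mapping.lookup f m))"
proof (rule poly_mapping_eqI)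
  fix k
  have "Poly_Mapping.lookup (Poly_Mapping.single m (Poly_Mapping.lookup f m)) k
      = (if m = k then Poly_Mapping.lookup f k else 0)" for m
    by (simp add: lookup_single when_def)
  then show "Poly_Mapping.lookup f k = Poly_Mapping.lookup
      (\<Sum>m\<in>Poly_Mapping.keys f. Poly_Mapping.single m (Poly_Mapping.lookup f m)) k"
    by (simp add: lookup_sum in_keys_iff)
qed

lemma poly_eval_mult: "poly_eval x (f * g) = poly_eval x f * poly_eval x g"
proof -
  define s where "s h m = Poly_Mapping.single m (Poly_Mapping.lookup h m)" for h :: "'a rpoly" and m
  have eq: "h = (\<Sum>m\<in>Poly_Mapping.keys h. s h m)" for h
    unfolding s_def by (rule poly_mapping_eq_sum_single)
  have single: "poly_eval x (s f m * s g m') = poly_eval x (s f m) * poly_eval x (s g m')" for m m'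
    by (simp add: s_def mult_single poly_eval_single monomial_eval_add)
  have "poly_eval x (f * g)
      = poly_eval x ((\<Sum>m\<in>Poly_Mapping.keys f. s f m) * (\<Sum>m\<in>Poly_Mapping.keys g. s g m))"
    by (simp only: eq[symmetric])
  also have "\<dots> = poly_eval x (\<Sum>m\<in>Poly_Mapping.keys f. s f m) * poly_eval x (\<Sum>m\<in>Poly_Mapping.keys g. s g m)"
    by (simp add: sum_product poly_eval_sum single)
  also have "\<dots> = poly_eval x f * poly_eval x g"
    by (simp only: eq[symmetric])
  finally show ?thesis .
qed

lemma poly_eval_const_poly [simp]: "poly_eval x (const_poly c) = c"
  by (simp add: const_poly_def poly_eval_single)

lemma poly_eval_1 [simp]: "poly_eval x 1 = 1"
  using poly_eval_single[of x 0 1] by simp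

lemma poly_eval_power: "poly_eval x (f ^ k) = poly_eval x f ^ k"
  by (induction k) (simp_all add: poly_eval_mult)

lemma poly_eval_diff: "poly_eval x (f - g) = poly_eval x f - poly_eval x g"
  using poly_eval_add[of x "f - g" g] by simp

interpretation poly: real_scalars "const_poly :: real \<Rightarrow> 'n::finite rpoly"
  by unfold_locales (simp_all add: const_poly_def single_add mult_single)

lemma character_poly_eval: "poly.character (poly_eval x)"
  by (simp add: poly.character_def poly.linear_functional_def poly_eval_add poly_eval_mult)

text \<open>The point collects the values of \<open>L\<close> at the indeterminates, which are the
  nested singles here. Multiplicativity determines \<open>L\<close> on monomials and linearity on
  all polynomials.\<close>

lemma character_eq_poly_eval:
  fixes L :: "'n::finite rpoly \<Rightarrow> real"
  assumes "poly.character L"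
  shows "L = poly_eval (\<chi> i. L (Poly_Mapping.single (Poly_Mapping.single i 1) 1))"
proof
  fix f
  define x where "x = (\<chi> i. L (Poly_Mapping.single (Poly_Mapping.single i 1) 1))"
  define \<phi> where "\<phi> m = L (Poly_Mapping.single m 1)" for m
  have lin: "poly.linear_functional L" and L1: "L 1 = 1" and mult: "\<And>f g. L (f * g) = L f * L g"
    using assms by (auto simp: poly.character_def)
  have \<phi>0: "\<phi> 0 = 1" using L1 by (simp add: \<phi>_def)
  have \<phi>_add: "\<phi> (m + m') = \<phi> m * \<phi> m'" for m m'
    by (simp add: \<phi>_def mult[symmetric] mult_single)
  have \<phi>_sum: "\<phi> (\<Sum>i\<in>I. m i) = (\<Prod>i\<in>I. \<phi> (m i))" for m :: "'n \<Rightarrow> _" and I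
    by (induction I rule: infinite_finite_induct) (simp_all add: \<phi>0 \<phi>_add)
  have \<phi>_single: "\<phi> (Poly_Mapping.single i n) = (x $ i) ^ n" for i n
  proof (induction n)
    case (Suc n)
    then show ?case
      using \<phi>_add[of "Poly_Mapping.single i 1" "Poly_Mapping.single i n"]
      by (simp add: single_add[symmetric] x_def \<phi>_def)
  qed (simp add: \<phi>0)
  have \<phi>_eq: "\<phi> m = monomial_eval x m" for m
  proof -
    have "m = (\<Sum>i\<in>UNIV. Poly_Mapping.single i (Poly_Mapping.lookup m i))"
      by (rule poly_mapping_eqI) (simp add: lookup_sum lookup_single when_def)
    then have "\<phi> m = \<phi> (\<Sum>i\<in>UNIV. Poly_Mapping.single i (Poly_Mapping.lookup m i))"
      by (rule arg_cong)
    also have "\<dots> = (\<Prod>i\<in>UNIV. \<phi> (Poly_Mapping.single i (Poly_Mapping.lookup m i)))"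
      by (rule \<phi>_sum)
    finally show ?thesis by (simp add: \<phi>_single monomial_eval_def)
  qed
  have L_sum: "L (\<Sum>i\<in>I. h i) = (\<Sum>i\<in>I. L (h i))" for h :: "('n \<Rightarrow>\<^sub>0 nat) \<Rightarrow> _" and I
    by (induction I rule: infinite_finite_induct) (simp_all add: poly.linear_functionalD[OF lin])
  have single: "L (Poly_Mapping.single m c) = c * \<phi> m" for m c
    using poly.linear_functionalD(2)[OF lin, of c "Poly_Mapping.single m 1"]
    by (simp add: const_poly_def mult_single \<phi>_def)
  have "L f = (\<Sum>m\<in>Poly_Mapping.keys f. L (Poly_Mapping.single m (Poly_Mapping.lookup f m)))"
    by (subst poly_mapping_eq_sum_single[of f]) (rule L_sum)
  also have "\<dots> = poly_eval x f"
    using poly_eval_superset[of "Poly_Mapping.keys f" f x] by (simp add: single \<phi>_eq)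
  finally show "L f = poly_eval x f" .
qed

lemma countable_exponents: "countable (UNIV :: ('n::finite \<Rightarrow>\<^sub>0 nat) set)"
proof -
  have "inj (Poly_Mapping.lookup :: ('n \<Rightarrow>\<^sub>0 nat) \<Rightarrow> 'n \<Rightarrow> nat)"
    by (simp add: inj_on_def)
  then show ?thesis
    by (rule countable_image_inj_on[rotated]) simp
qed

text \<open>Countably many exponents allow the monomials to be listed as a sequence, the form that
  successive maximization takes as input.\<close>

lemma spanning_monomials:
  "poly.spanning (range (\<lambda>k. Poly_Mapping.single (from_nat_into (UNIV :: ('n::finite \<Rightarrow>\<^sub>0 nat) set) k) 1))"
  unfolding poly.spanning_def
proof (intro allI impI)
  fix S :: "'n rpoly set"
  assume mon: "range (\<lambda>k. Poly_Mapping.single (from_nat_into UNIV k) 1) \<subseteq> S" and "0 \<in> S"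
    and add: "\<forall>a\<in>S. \<forall>b\<in>S. a + b \<in> S" and scale: "\<forall>c. \<forall>a\<in>S. const_poly c * a \<in> S"
  have single: "Poly_Mapping.single m c \<in> S" for m c
  proof -
    obtain k where "m = from_nat_into UNIV k"
      using from_nat_into_surj[OF countable_exponents, of m] by auto
    then have "Poly_Mapping.single m 1 \<in> S" using mon by auto
    then have "const_poly c * Poly_Mapping.single m 1 \<in> S" using scale by blast
    then show ?thesis by (simp add: const_poly_def mult_single)
  qed
  have sum: "(\<Sum>i\<in>I. h i) \<in> S" if "\<And>i. h i \<in> S" for h :: "('n \<Rightarrow>\<^sub>0 nat) \<Rightarrow> 'n rpoly" and I
    by (induction I rule: infinite_finite_induct) (use \<open>0 \<in> S\<close> add that in auto)
  have "f \<in> S" for f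
    by (subst poly_mapping_eq_sum_single[of f], rule sum, rule single)
  then show "S = UNIV" by auto
qed

section \<open>The cone of sums of powers\<close>

lemma sums_of_powers_0: "0 \<in> sums_of_powers k"
  unfolding sums_of_powers_def by (auto intro!: exI[of _ "0::nat"])

lemma power_in_sums_of_powers: "g ^ k \<in> sums_of_powers k"
  unfolding sums_of_powers_def
  by (rule CollectI, rule exI[of _ 1], rule exI[of _ "\<lambda>_. g"]) simp

lemma sums_of_powers_add:
  assumes "f \<in> sums_of_powers k" "g \<in> sums_of_powers k"
  shows "f + g \<in> sums_of_powers k"
proof -
  obtain r a s b where f: "f = (\<Sum>i<(r::nat). a i ^ k)" and g: "g = (\<Sum>i<(s::nat). b i ^ k)"
    using assms unfolding sums_of_powers_def by auto
  define c where "c i = (if i < r then a i else b (i - r))" for i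
  have "(\<Sum>i<r + s. c i ^ k) = (\<Sum>i<r. c i ^ k) + (\<Sum>i<s. c (r + i) ^ k)"
    by (induction s) (simp_all add: add.assoc)
  also have "\<dots> = f + g"
    by (simp add: f g c_def)
  finally show ?thesis unfolding sums_of_powers_def by (metis (mono_tags, lifting) mem_Collect_eq)
qed

lemma sums_of_powers_sum:
  assumes "\<And>i. i \<in> I \<Longrightarrow> f i \<in> sums_of_powers k"
  shows "(\<Sum>i\<in>I. f i) \<in> sums_of_powers k"
  using assms
  by (induction I rule: infinite_finite_induct) (simp_all add: sums_of_powers_0 sums_of_powers_add)

text \<open>In a commutative ring \<open>a i ^ k * b j ^ k\<close> is again a \<open>k\<close>-th
  power, so the expanded product is a sum of powers.\<close>

lemma sums_of_powers_mult:
  assumes "f \<in> sums_of_powers k" "g \<in> sums_of_powers k"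
  shows "f * g \<in> sums_of_powers k"
proof -
  obtain r a s b where f: "f = (\<Sum>i<(r::nat). a i ^ k)" and g: "g = (\<Sum>i<(s::nat). b i ^ k)"
    using assms unfolding sums_of_powers_def by auto
  have "f * g = (\<Sum>i<r. \<Sum>j<s. (a i * b j) ^ k)"
    by (simp add: f g sum_product power_mult_distrib)
  also have "\<dots> \<in> sums_of_powers k"
    by (intro sums_of_powers_sum power_in_sums_of_powers)
  finally show ?thesis .
qed

lemma const_poly_in_sums_of_powers:
  fixes k :: nat
  assumes "k > 0" "c \<ge> 0"
  shows "const_poly c \<in> (sums_of_powers k :: 'n::finite rpoly set)"
proof -
  have "const_poly a ^ j = (const_poly (a ^ j) :: 'n rpoly)" for a j
    by (induction j) (simp_all add: poly.scalar_mult)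
  then have "const_poly c = (const_poly (root k c) ^ k :: 'n rpoly)"
    using assms by simp
  then show ?thesis using power_in_sums_of_powers by metis
qed

section \<open>Power sums, their closures and nonnegativity on the Gelfand spectrum\<close>

theorem proposition6p5:
  fixes N :: "'n::finite rpoly \<Rightarrow> real"
  assumes "is_poly_norm N"
    and "\<And>f g. N (f * g) \<le> N f * N g"
  shows "(\<forall>U. openin (seminorm_topology (sup_seminorm (gelfand_spectrum N))) U
               \<longrightarrow> openin (seminorm_topology N) U) \<and>
    (\<forall>d::nat. d \<ge> 1 \<longrightarrow>
       seminorm_topology N closure_of (sums_of_powers (2 * d))
         = seminorm_topology (sup_seminorm (gelfand_spectrum N)) closure_of (sums_of_powers (2 * d)) \<and>
       seminorm_topology (sup_seminorm (gelfand_spectrum N)) closure_of (sums_of_powers (2 * d))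
         = Psd (gelfand_spectrum N))"
proof -
  interpret submultiplicative_norm const_poly N
    using assms by unfold_locales (auto simp: is_poly_norm_def)
  define K where "K = gelfand_spectrum N"
  define p where "p = sup_seminorm K"
  have lin: "poly.linear_functional (poly_eval x)" for x
    using character_poly_eval[of x] by (simp add: poly.character_def)
  have K_iff: "x \<in> K \<longleftrightarrow> (\<exists>C. \<forall>f. \<bar>poly_eval x f\<bar> \<le> C * N f)" for x
    by (simp add: K_def gelfand_spectrum_def continuous_linear_functional_iff[OF lin])
  \<comment> \<open>With constant 1 the bound is uniform over \<open>K\<close>: this makes the
    supremum finite and gives \<open>p \<le> N\<close>, hence the comparison of the
    topologies.\<close>
  have eval_le_norm: "\<bar>poly_eval x f\<bar> \<le> N f" if x: "x \<in> K" for x f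
  proof -
    obtain C where "\<And>f. \<bar>poly_eval x f\<bar> \<le> C * N f" using x K_iff by auto
    then show ?thesis by (rule character_le_norm[OF character_poly_eval])
  qed
  have eval_le_p: "\<bar>poly_eval x f\<bar> \<le> p f" if "x \<in> K" for x f
  proof -
    have "bdd_above ((\<lambda>x. \<bar>poly_eval x f\<bar>) ` K)"
      using eval_le_norm by (intro bdd_aboveI2)
    then have "\<bar>poly_eval x f\<bar> \<le> (SUP x\<in>K. \<bar>poly_eval x f\<bar>)"
      using that by (intro cSUP_upper)
    with that show ?thesis by (auto simp: p_def sup_seminorm_def)
  qed
  have p_le_norm: "p f \<le> N f" for f
    unfolding p_def sup_seminorm_def using eval_le_norm by (auto intro!: cSUP_least)
  have finer: "openin (seminorm_topology N) U" if "openin (seminorm_topology p) U" for U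
    using that p_le_norm order_le_less_trans unfolding openin_seminorm_topology by metis
  \<comment> \<open>Both equalities come from a cycle of inclusions: the \<open>N\<close>-closure
    lies in the \<open>p\<close>-closure, that one in \<open>Psd K\<close>, and \<open>Psd K\<close>
    in the \<open>N\<close>-closure.\<close>
  have "seminorm_topology N closure_of S \<subseteq> seminorm_topology p closure_of S" for S
    using finer unfolding in_closure_of subset_iff by simp
  moreover have "seminorm_topology p closure_of (sums_of_powers (2 * d)) \<subseteq> Psd K" for d
  proof (rule closure_of_minimal)
    show "sums_of_powers (2 * d) \<subseteq> Psd K"
      by (auto simp: sums_of_powers_def Psd_def poly_eval_sum poly_eval_power intro!: sum_nonneg)
    \<comment> \<open>If \<open>f\<close> is negative at \<open>x \<in> K\<close>, every
      \<open>g\<close> within \<open>p\<close>-distance \<open>- poly_eval x f\<close> is still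
      negative at \<open>x\<close>, so the complement of \<open>Psd K\<close> is open.\<close>
    have "\<exists>e>0. \<forall>g. p (g - f) < e \<longrightarrow> g \<notin> Psd K" if f: "f \<notin> Psd K" for f
    proof -
      obtain x where x: "x \<in> K" "poly_eval x f < 0"
        using f by (auto simp: Psd_def not_le)
      have "g \<notin> Psd K" if "p (g - f) < - poly_eval x f" for g
        using eval_le_p[OF x(1), of "g - f"] that x(1)
        by (force simp: Psd_def poly_eval_diff abs_le_iff)
      with x(2) show ?thesis by (intro exI[of _ "- poly_eval x f"]) auto
    qed
    then show "closedin (seminorm_topology p) (Psd K)"
      by (simp add: closedin_def openin_seminorm_topology)
  qed
  moreover have "Psd K \<subseteq> seminorm_topology N closure_of (sums_of_powers (2 * d))" if d: "d \<ge> 1" for d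
  proof (rule ccontr)
    assume "\<not> Psd K \<subseteq> seminorm_topology N closure_of (sums_of_powers (2 * d))"
    then obtain f where f: "f \<in> Psd K" "f \<notin> seminorm_topology N closure_of (sums_of_powers (2 * d))"
      by auto
    obtain L C where L: "poly.character L" "\<forall>a. \<bar>L a\<bar> \<le> C * N a" "L f < 0"
      by (rule separating_character_exists[OF sums_of_powers_add sums_of_powers_mult
            const_poly_in_sums_of_powers _ power_in_sums_of_powers f(2) spanning_monomials])
        (use d in auto)
    \<comment> \<open>The separating character is a point evaluation, and its norm bound puts the
      point in \<open>K\<close>, where \<open>f\<close> cannot be negative.\<close>
    obtain x where x: "L = poly_eval x"
      using character_eq_poly_eval[OF L(1)] by blast
    then have "x \<in> K" using L(2) K_iff by auto
    with f(1) L(3) x show False by (force simp: Psd_def)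
  qed
  ultimately show ?thesis
    using finer unfolding p_def K_def by (meson order_trans subset_antisym)
qed

end
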